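(* Let $F$ be a continuous distribution function on $\mathbb{R}$ with density $f$. Let $n_1,n_2\ge 1$ be integers, $n=n_1+n_2$, and let $\alpha,\alpha^*,\beta,\beta^*,\gamma,\gamma^*>0$. Let $U_1,\dots,U_n$ be mutually independent random variables and $V_1,\dots,V_n$ be mutually independent random variables such that $U_i\sim Kw\text{-}G(\alpha,\beta,F)$ and $V_i\sim Kw\text{-}G(\gamma,\beta,F)$ for $i=1,\dots,n_1$, and $U_i\sim Kw\text{-}G(\alpha^*,\beta^*,F)$ and $V_i\sim Kw\text{-}G(\gamma^*,\beta^*,F)$ for $i=n_1+1,\dots,n$. If $\alpha>\alpha^*$, $\gamma>\gamma^*$ and $\beta<\beta^*$, and if $$(\underbrace{\alpha,\dots,\alpha}_{n_1},\underbrace{\alpha^*,\dots,\alpha^*}_{n_2})\stackrel{m}{\succeq}(\underbrace{\gamma,\dots,\gamma}_{n_1},\underbrace{\gamma^*,\dots,\gamma^*}_{n_2}),$$ then $U_{1:n}\le_{lr}V_{1:n}$.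
   Context: For $\alpha,\beta>0$ and a distribution function $F$, $X\sim Kw\text{-}G(\alpha,\beta,F)$ means that $X$ has distribution function $x\mapsto 1-(1-F^{\alpha}(x))^{\beta}$, $x\in\mathbb{R}$, where $F^\alpha(x)=(F(x))^\alpha$. $U_{1:n}=\min(U_1,\dots,U_n)$ and $V_{1:n}=\min(V_1,\dots,V_n)$. For real vectors $\mathbf{x},\mathbf{y}$ of length $n$ with increasing rearrangements $x_{(1)}\le\cdots\le x_{(n)}$ and $y_{(1)}\le\cdots\le y_{(n)}$, $\mathbf{x}\stackrel{m}{\succeq}\mathbf{y}$ ($\mathbf{x}$ majorizes $\mathbf{y}$) means $\sum_{i=1}^j x_{(i)}\le\sum_{i=1}^j y_{(i)}$ for $j=1,\dots,n-1$ and $\sum_{i=1}^n x_{(i)}=\sum_{i=1}^n y_{(i)}$. Likelihood ratio order: for absolutely continuous $X,Y$, $X\le_{lr}Y$ means that, for suitable versions $f_X,f_Y$ of their densities, $f_Y(t)/f_X(t)$ is increasing in $t$ (at points where numerator and denominator are not both zero, with $a/0=\infty$ for $a>0$, as usual). "Increasing" means nondecreasing. *)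

theory Defs
  imports "HOL-Probability.Probability"
begin

text \<open>
  \<open>KwG M X a b F\<close>: on the probability space \<open>M\<close>, the real random variable \<open>X\<close> follows the
  Kumaraswamy-G law with shape parameters \<open>a\<close>, \<open>b\<close> and baseline distribution function \<open>F\<close>.
  Since \<open>0 powr a = 0\<close>, the formula is the intended one at the points where \<open>F\<close> is 0 or 1
  as long as \<open>a\<close> and \<open>b\<close> are positive.
\<close>

definition KwG :: "'a measure \<Rightarrow> ('a \<Rightarrow> real) \<Rightarrow> real \<Rightarrow> real \<Rightarrow> (real \<Rightarrow> real) \<Rightarrow> bool" where
  "KwG M X a b F \<longleftrightarrow>
     X \<in> borel_measurable M \<and>
     (\<forall>x. cdf (distr M borel X) x = 1 - (1 - F x powr a) powr b)"

text \<open>The first order statistic of \<open>X 1, \<dots>, X n\<close> (for \<open>n \<ge> 1\<close>).\<close>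

definition min_stat :: "nat \<Rightarrow> (nat \<Rightarrow> 'a \<Rightarrow> real) \<Rightarrow> 'a \<Rightarrow> real" where
  "min_stat n X \<omega> = Min ((\<lambda>i. X i \<omega>) ` {1..n})"

text \<open>
  \<open>majorizes xs ys\<close>: vectors are lists, and \<open>take j (sort xs)\<close> consists of the \<open>j\<close> smallest entries
  of \<open>xs\<close>, counted with multiplicity.
\<close>

definition majorizes :: "real list \<Rightarrow> real list \<Rightarrow> bool" where
  "majorizes xs ys \<longleftrightarrow>
     length xs = length ys \<and>
     (\<forall>j\<in>{1..<length xs}. sum_list (take j (sort xs)) \<le> sum_list (take j (sort ys))) \<and>
     sum_list xs = sum_list ys"

text \<open>
  Likelihood ratio order. The two variables may live on different probability spaces. The versions
  of the densities are real-valued, and the quotient is taken in \<^typ>\<open>ennreal\<close>, where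
  \<open>a / 0 = \<infinity>\<close> for \<open>a > 0\<close>; the points where both densities vanish are left out.
\<close>

definition lr_le :: "'a measure \<Rightarrow> ('a \<Rightarrow> real) \<Rightarrow> 'b measure \<Rightarrow> ('b \<Rightarrow> real) \<Rightarrow> bool" where
  "lr_le M X N Y \<longleftrightarrow>
     (\<exists>fX fY :: real \<Rightarrow> real.
        (\<forall>t. 0 \<le> fX t) \<and> (\<forall>t. 0 \<le> fY t) \<and>
        distributed M lborel X (\<lambda>t. ennreal (fX t)) \<and>
        distributed N lborel Y (\<lambda>t. ennreal (fY t)) \<and>
        mono_on {t. fX t \<noteq> 0 \<or> fY t \<noteq> 0} (\<lambda>t. ennreal (fY t) / ennreal (fX t)))"

end

theory Submission
  imports Defs
begin

text \<open>
  With \<open>p = n1 \<beta>\<close>, \<open>q = n2 \<beta>'\<close>, the minimum has survival function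
  \<open>(1 - u\<^sup>a)\<^sup>p (1 - u\<^sup>b)\<^sup>q\<close> at \<open>u = F t\<close>, and since \<open>F\<close> pushes \<open>D\<close> forward to the uniform law, its density is
  a function of \<open>u\<close> times \<open>f t\<close>. The factor \<open>f\<close> cancels in the likelihood ratio, so that only
  monotonicity in \<open>u\<close>, or in \<open>x = - ln u\<close>, is left.

  Let \<open>h t = t / (e\<^sup>t - 1)\<close> and \<open>k t = t + h t\<close>, so that \<open>t h' t = h t (1 - k t)\<close>. The logarithm of the survival function has
  \<open>x\<close>-derivative \<open>H / x\<close> and the hazard rate is \<open>H\<close> up to a factor free of \<open>a\<close> and \<open>b\<close>, where
  \<open>H = p h(ax) + q h(bx)\<close>; moreover \<open>x H' = H - K\<close> with \<open>K = p h(ax) k(ax) + q h(bx) k(bx)\<close>.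
  Hence the log-density has \<open>x\<close>-derivative \<open>(H - K / H) / x\<close> plus a term free of \<open>a\<close> and \<open>b\<close>. When \<open>a\<close> and \<open>b\<close> move towards each
  other with \<open>n1 a + n2 b\<close> fixed, \<open>H\<close> decreases because \<open>h\<close> is decreasing and convex and
  \<open>\<beta> \<le> \<beta>'\<close>, and \<open>K / H\<close> increases because in addition \<open>k\<close> is increasing and \<open>h k'\<close> is decreasing.
\<close>

subsection \<open>The function \<open>t / (exp t - 1)\<close>\<close>

text \<open>\<open>h\<close> of the overview, the generating function of the Bernoulli numbers. By
  the convention on division its value at 0 is 0 and not the limit 1, so the facts about it are
  stated for positive arguments.\<close>

definition bern :: "real \<Rightarrow> real" where
  "bern t = t / (exp t - 1)"

definition bern' :: "real \<Rightarrow> real" where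
  "bern' t = (exp t - 1 - t * exp t) / (exp t - 1)\<^sup>2"

lemma bern_pos: "t > 0 \<Longrightarrow> bern t > 0"
  by (simp add: bern_def)

lemma bern_deriv [derivative_intros]:
  assumes "(g has_real_derivative g') (at x within A)" "g x > 0"
  shows "((\<lambda>x. bern (g x)) has_real_derivative bern' (g x) * g') (at x within A)"
proof -
  have "(bern has_real_derivative bern' (g x)) (at (g x))"
    unfolding bern_def[abs_def] bern'_def using assms(2)
    by (auto intro!: derivative_eq_intros simp: power2_eq_square algebra_simps)
  from DERIV_chain2[OF this assms(1)] show ?thesis .
qed

text \<open>Serves to prove inequalities between polynomials in \<open>t\<close> and
  \<open>exp t\<close> by differentiating until the sign is plain.\<close>

lemma nonneg_by_deriv:
  fixes P P' :: "real \<Rightarrow> real"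
  assumes "\<And>x. (P has_real_derivative P' x) (at x)" "\<And>x. x \<ge> 0 \<Longrightarrow> P' x \<ge> 0"
    "P 0 \<ge> 0" "t \<ge> 0"
  shows "P t \<ge> 0"
  using DERIV_nonneg_imp_nondecreasing[of 0 t P] assms by force

lemma mult_exp_ge:
  fixes t :: real
  assumes "t \<ge> 0"
  shows "t * exp t - exp t + 1 \<ge> 0"
  by (rule nonneg_by_deriv[of "\<lambda>t. t * exp t - exp t + 1" "\<lambda>t. t * exp t"])
     (use assms in \<open>auto intro!: derivative_eq_intros\<close>)

lemma bern'_nonpos:
  assumes "t > 0"
  shows "bern' t \<le> 0"
  using mult_exp_ge[of t] assms by (auto simp: bern'_def intro!: divide_nonpos_nonneg)

text \<open>\<open>1 + bern'\<close> is the derivative \<open>k'\<close>. In this form its sign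
  follows from \<open>1 + t \<le> exp t\<close>.\<close>

lemma one_plus_bern':
  assumes "t > 0"
  shows "1 + bern' t = exp t * (exp t - 1 - t) / (exp t - 1)\<^sup>2"
proof -
  have "1 + bern' t = ((exp t - 1)\<^sup>2 + (exp t - 1 - t * exp t)) / (exp t - 1)\<^sup>2"
    using assms by (simp add: bern'_def add_divide_distrib)
  also have "(exp t - 1)\<^sup>2 + (exp t - 1 - t * exp t) = exp t * (exp t - 1 - t)"
    by (simp add: power2_eq_square algebra_simps)
  finally show ?thesis .
qed

lemma one_plus_bern'_nonneg:
  assumes "t > 0"
  shows "1 + bern' t \<ge> 0"
  unfolding one_plus_bern'[OF assms] using exp_ge_add_one_self[of t]
  by (intro divide_nonneg_nonneg mult_nonneg_nonneg) (simp_all add: algebra_simps)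

text \<open>Convexity of \<open>h\<close>: up to a positive factor the second derivative is
  \<open>(t - 2) * exp t + t + 2\<close>, which vanishes at 0 and whose derivative is the expression
  of \<open>mult_exp_ge\<close>.\<close>

lemma bern'_mono:
  assumes "0 < s" "s \<le> t"
  shows "bern' s \<le> bern' t"
proof (rule DERIV_nonneg_imp_nondecreasing[OF assms(2)])
  fix x assume "s \<le> x" "x \<le> t"
  then have x: "x > 0" using assms by simp
  define y where "y = exp x"
  have "((\<lambda>t. (t - 2) * exp t + t + 2) has_real_derivative t * exp t - exp t + 1) (at t)" for t :: real
    by (rule derivative_eq_intros refl)+ (simp add: algebra_simps)
  from nonneg_by_deriv[OF this mult_exp_ge, of x]
  have num: "(x - 2) * exp x + x + 2 \<ge> 0"
    using x by simp
  have y: "y - 1 > 0" using x by (simp add: y_def)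
  have "(bern' has_real_derivative
      (- (x * y) * (y - 1)\<^sup>2 - (y - 1 - x * y) * (2 * (y - 1) * y)) / ((y - 1)\<^sup>2)\<^sup>2) (at x)"
    unfolding bern'_def[abs_def] y_def using x
    by (auto intro!: derivative_eq_intros simp: power2_eq_square)
  also have "(- (x * y) * (y - 1)\<^sup>2 - (y - 1 - x * y) * (2 * (y - 1) * y)) / ((y - 1)\<^sup>2)\<^sup>2
      = ((y - 1) * (y * ((x - 2) * y + x + 2))) / ((y - 1) * (y - 1) ^ 3)"
    by (rule arg_cong2[where f="(/)"]) (simp_all add: power2_eq_square power3_eq_cube algebra_simps)
  also have "\<dots> = y * ((x - 2) * y + x + 2) / (y - 1) ^ 3"
    using y by simp
  finally show "\<exists>z. (bern' has_real_derivative z) (at x) \<and> z \<ge> 0"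
    using num y unfolding y_def by (intro exI conjI) (assumption, auto)
qed

text \<open>The left-hand side is the numerator of the derivative of \<open>bern * (1 + bern')\<close>; it vanishes to
  fourth order at 0, so it is differentiated three times.\<close>

lemma bern_numerator_nonpos:
  fixes t :: real
  assumes "t \<ge> 0"
  shows "(1 - t) * (exp t)\<^sup>2 + (2*t\<^sup>2 - 2*t - 2) * exp t + (t\<^sup>2 + 3*t + 1) \<le> 0"
proof -
  let ?P = "\<lambda>t::real. - ((1 - t) * (exp t)\<^sup>2 + (2*t\<^sup>2 - 2*t - 2) * exp t + (t\<^sup>2 + 3*t + 1))"
  let ?P1 = "\<lambda>t::real. - ((1 - 2*t) * (exp t)\<^sup>2 + (2*t\<^sup>2 + 2*t - 4) * exp t + (2*t + 3))"
  let ?P2 = "\<lambda>t::real. - (- 4 * t * (exp t)\<^sup>2 + (2*t\<^sup>2 + 6*t - 2) * exp t + 2)"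
  let ?P3 = "\<lambda>t::real. exp t * ((4 + 8*t) * exp t - (2*t\<^sup>2 + 10*t + 4))"
  have 3: "?P3 t \<ge> 0" if "t \<ge> 0" for t
  proof -
    have "(4 + 8*t) * exp t \<ge> (4 + 8*t) * (1 + t)"
      using that by (intro mult_left_mono) auto
    moreover have "(4 + 8*t) * (1 + t) \<ge> 2*t\<^sup>2 + 10*t + 4"
      using that by (simp add: algebra_simps power2_eq_square)
    ultimately show ?thesis by simp
  qed
  have "(?P2 has_real_derivative ?P3 t) (at t)" for t
    by (rule derivative_eq_intros refl)+ (simp add: algebra_simps power2_eq_square)
  from nonneg_by_deriv[OF this 3]
  have 2: "?P2 t \<ge> 0" if "t \<ge> 0" for t
    using that by simp
  have "(?P1 has_real_derivative ?P2 t) (at t)" for t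
    by (rule derivative_eq_intros refl)+ (simp add: algebra_simps power2_eq_square)
  from nonneg_by_deriv[OF this 2]
  have 1: "?P1 t \<ge> 0" if "t \<ge> 0" for t
    using that by simp
  have "(?P has_real_derivative ?P1 t) (at t)" for t
    by (rule derivative_eq_intros refl)+ (simp add: algebra_simps power2_eq_square)
  from nonneg_by_deriv[OF this 1]
  have "?P t \<ge> 0"
    using assms by simp
  then show ?thesis by simp
qed

text \<open>For the product \<open>h k'\<close>, with the closed form \<open>?f\<close>, the
  derivative has the sign of the expression in \<open>bern_numerator_nonpos\<close> once
  \<open>(exp t - 1)\<^sup>2\<close> is cancelled.\<close>

lemma bern_mult_antimono:
  assumes "0 < s" "s \<le> t"
  shows "bern t * (1 + bern' t) \<le> bern s * (1 + bern' s)"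
proof -
  let ?f = "\<lambda>t. t * exp t * (exp t - 1 - t) / (exp t - 1) ^ 3"
  have eq: "bern x * (1 + bern' x) = ?f x" if "x > 0" for x
    using that by (simp add: one_plus_bern' bern_def power2_eq_square power3_eq_cube mult.assoc)
  have "?f t \<le> ?f s"
  proof (rule DERIV_nonpos_imp_nonincreasing[OF assms(2)])
    fix x assume "s \<le> x" "x \<le> t"
    then have x: "x > 0" using assms by simp
    define y where "y = exp x"
    have y: "y - 1 > 0" using x by (simp add: y_def)
    have "(?f has_real_derivative
        (((y + x * y) * (y - 1 - x) + x * y * (y - 1)) * (y - 1) ^ 3
          - x * y * (y - 1 - x) * (3 * (y - 1)\<^sup>2 * y)) / ((y - 1) ^ 3)\<^sup>2) (at x)"
      unfolding y_def using x
      by (auto intro!: derivative_eq_intros simp: power2_eq_square algebra_simps)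
    also have "(((y + x * y) * (y - 1 - x) + x * y * (y - 1)) * (y - 1) ^ 3
          - x * y * (y - 1 - x) * (3 * (y - 1)\<^sup>2 * y)) / ((y - 1) ^ 3)\<^sup>2
        = ((y - 1)\<^sup>2 * (y * ((1 - x) * y\<^sup>2 + (2*x\<^sup>2 - 2*x - 2) * y + (x\<^sup>2 + 3*x + 1))))
            / ((y - 1)\<^sup>2 * (y - 1) ^ 4)"
      by (rule arg_cong2[where f="(/)"]) algebra+
    also have "\<dots> = y * ((1 - x) * y\<^sup>2 + (2*x\<^sup>2 - 2*x - 2) * y + (x\<^sup>2 + 3*x + 1)) / (y - 1) ^ 4"
      by (rule mult_divide_mult_cancel_left) (use y in simp)
    finally show "\<exists>z. (?f has_real_derivative z) (at x) \<and> z \<le> 0"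
      using bern_numerator_nonpos[of x] x unfolding y_def
      by (intro exI conjI) (assumption, auto intro!: divide_nonpos_nonneg mult_nonneg_nonpos)
  qed
  with eq assms show ?thesis by simp
qed

section \<open>Monotonicity of \<open>H\<close> and \<open>K / H\<close> along a segment\<close>

text \<open>The numerator of the derivative of \<open>K / H\<close> along the path used in \<open>bern_path\<close>, with \<open>h\<^sub>i\<close>, \<open>d\<^sub>i\<close>, \<open>k\<^sub>i\<close>
  the values of \<open>bern\<close>, \<open>bern'\<close> and \<open>t + bern t\<close> at the two arguments.\<close>

lemma path_numerator_nonneg:
  fixes h1 h2 d1 d2 k1 k2 m1 m2 \<beta> \<beta>' :: real
  assumes pos: "m1 > 0" "m2 > 0" "0 < \<beta>" "\<beta> \<le> \<beta>'" "h1 > 0" "h2 > 0"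
    and d: "d1 \<le> 0" "d2 \<le> 0" "0 \<le> 1 + d1" and k: "k2 \<le> k1"
    and hk: "h1 * (1 + d1) \<le> h2 * (1 + d2)"
  shows "0 \<le> (- m2 * (m1*\<beta>) * (d1 * k1 + h1 * (1 + d1)) + m1 * (m2*\<beta>') * (d2 * k2 + h2 * (1 + d2)))
              * (m1*\<beta> * h1 + m2*\<beta>' * h2)
           - (m1*\<beta> * (h1 * k1) + m2*\<beta>' * (h2 * k2)) * (- m2 * (m1*\<beta>) * d1 + m1 * (m2*\<beta>') * d2)"
    (is "0 \<le> ?rhs")
proof -
  have le: "\<beta> * (h1 * (1 + d1)) \<le> \<beta>' * (h2 * (1 + d2))"
    by (rule mult_mono[OF pos(4) hk]) (use pos d in auto)
  have d2: "\<beta>' * (- d2) * (k1 - k2) \<ge> 0"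
    using pos d k by (intro mult_nonneg_nonneg) simp_all
  have d1: "\<beta> * (- d1) * (k1 - k2) \<ge> 0"
    using pos d k by (intro mult_nonneg_nonneg) simp_all
  \<comment> \<open>The right-hand side is sorted by \<open>m1 * \<beta> * h1\<close> and
    \<open>m2 * \<beta>' * h2\<close>. In the coefficient of the first the terms
    \<open>d1 * k1\<close> cancel, in that of the second the terms \<open>d2 * k2\<close>; what
    remains of the \<open>k\<close> terms is a multiple of \<open>k1 - k2\<close>.\<close>
  have "0 \<le> (m1 * m2) * (m1 * \<beta> * h1 * (\<beta>' * (h2 * (1 + d2)) + \<beta>' * (- d2) * (k1 - k2) - \<beta> * (h1 * (1 + d1)))
        + m2 * \<beta>' * h2 * (\<beta>' * (h2 * (1 + d2)) + \<beta> * (- d1) * (k1 - k2) - \<beta> * (h1 * (1 + d1))))"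
    using le d1 d2 pos by (intro mult_nonneg_nonneg add_nonneg_nonneg) auto
  also have "\<dots> = ?rhs" by algebra
  finally show ?thesis .
qed

text \<open>Both quantities are monotone along the segment from \<open>(A, B)\<close> to \<open>(C, D)\<close>, on which
  \<open>m1 * t1 + m2 * t2\<close> is constant.\<close>

lemma bern_path:
  fixes A B C D m1 m2 \<beta> \<beta>' :: real
  assumes ord: "0 < B" "B \<le> D" "D \<le> C" and sum: "m1 * A + m2 * B = m1 * C + m2 * D"
    and pos: "m1 > 0" "m2 > 0" "0 < \<beta>" "\<beta> \<le> \<beta>'"
  defines "H \<equiv> \<lambda>a b. m1*\<beta> * bern a + m2*\<beta>' * bern b"
    and "K \<equiv> \<lambda>a b. m1*\<beta> * (bern a * (a + bern a)) + m2*\<beta>' * (bern b * (b + bern b))"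
  shows "H C D \<le> H A B" "K A B / H A B \<le> K C D / H C D"
proof -
  \<comment> \<open>The path \<open>(A - s * m2, B + s * m1)\<close> reaches \<open>(C, D)\<close>
    at \<open>s'\<close>: the second coordinate by this choice, the first because the weighted sum
    is constant.\<close>
  define s' where "s' = (D - B) / m1"
  have s': "s' \<ge> 0" "B + s' * m1 = D" using ord pos by (auto simp: s'_def)
  have "m1 * (A - s' * m2) = m1 * C"
    using sum s'(2) by algebra
  then have C: "A - s' * m2 = C" using pos by simp
  define t1 where "t1 = (\<lambda>s. A - s * m2)"
  define t2 where "t2 = (\<lambda>s. B + s * m1)"
  have t: "0 < t2 s" "t2 s \<le> t1 s" if "0 \<le> s" "s \<le> s'" for s
  proof -
    show "0 < t2 s" using that ord pos by (simp add: t2_def add_pos_nonneg)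
    have "t2 s \<le> D" using that pos s' by (auto simp: t2_def)
    moreover have "C \<le> t1 s" using that pos C by (auto simp: t1_def)
    ultimately show "t2 s \<le> t1 s" using ord by simp
  qed
  have der: "(t1 has_real_derivative - m2) (at s)" "(t2 has_real_derivative m1) (at s)" for s
    unfolding t1_def t2_def by (auto intro!: derivative_eq_intros)
  let ?H' = "\<lambda>s. - m2 * (m1*\<beta>) * bern' (t1 s) + m1 * (m2*\<beta>') * bern' (t2 s)"
  let ?K' = "\<lambda>s. - m2 * (m1*\<beta>) * (bern' (t1 s) * (t1 s + bern (t1 s)) + bern (t1 s) * (1 + bern' (t1 s)))
     + m1 * (m2*\<beta>') * (bern' (t2 s) * (t2 s + bern (t2 s)) + bern (t2 s) * (1 + bern' (t2 s)))"
  have H': "((\<lambda>s. H (t1 s) (t2 s)) has_real_derivative ?H' s) (at s)" if "0 \<le> s" "s \<le> s'" for s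
    unfolding H_def using t[OF that] by (auto intro!: derivative_eq_intros der)
  have K': "((\<lambda>s. K (t1 s) (t2 s)) has_real_derivative ?K' s) (at s)" if "0 \<le> s" "s \<le> s'" for s
    unfolding K_def using t[OF that] by (auto intro!: derivative_eq_intros der simp: algebra_simps)
  have Hpos: "H (t1 s) (t2 s) > 0" if "0 \<le> s" "s \<le> s'" for s
    unfolding H_def using t[OF that] pos by (auto intro!: add_pos_pos mult_pos_pos bern_pos)
  have ends: "t1 0 = A" "t2 0 = B" "t1 s' = C" "t2 s' = D"
    using C s' by (auto simp: t1_def t2_def)
  have "H (t1 s') (t2 s') \<le> H (t1 0) (t2 0)"
  proof (rule DERIV_nonpos_imp_nonincreasing[OF s'(1)])
    fix s assume s: "0 \<le> s" "s \<le> s'"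
    \<comment> \<open>As \<open>bern'\<close> is nonpositive, the smaller factor
      \<open>\<beta>\<close> can only raise the term; convexity then moves the argument from
      \<open>t2 s\<close> to \<open>t1 s\<close>.\<close>
    have "\<beta>' * bern' (t2 s) \<le> \<beta> * bern' (t2 s)"
      using pos bern'_nonpos t[OF s] by (intro mult_right_mono_neg) auto
    also have "\<dots> \<le> \<beta> * bern' (t1 s)"
      using pos bern'_mono t[OF s] by (intro mult_left_mono) auto
    finally have "m1 * m2 * (\<beta>' * bern' (t2 s) - \<beta> * bern' (t1 s)) \<le> 0"
      using pos by (intro mult_nonneg_nonpos) auto
    then have "?H' s \<le> 0" by (simp add: algebra_simps)
    then show "\<exists>z. ((\<lambda>s. H (t1 s) (t2 s)) has_real_derivative z) (at s) \<and> z \<le> 0"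
      using H'[OF s] by blast
  qed
  then show "H C D \<le> H A B" by (simp add: ends)
  have "K (t1 0) (t2 0) / H (t1 0) (t2 0) \<le> K (t1 s') (t2 s') / H (t1 s') (t2 s')"
  proof (rule DERIV_nonneg_imp_nondecreasing[OF s'(1)])
    fix s assume s: "0 \<le> s" "s \<le> s'"
    have k: "t2 s + bern (t2 s) \<le> t1 s + bern (t1 s)"
    proof (rule DERIV_nonneg_imp_nondecreasing[OF t(2)[OF s]])
      fix x assume "t2 s \<le> x" "x \<le> t1 s"
      then have "x > 0" using t[OF s] by simp
      then show "\<exists>z. ((\<lambda>x. x + bern x) has_real_derivative z) (at x) \<and> z \<ge> 0"
        using one_plus_bern'_nonneg
        by (intro exI[of _ "1 + bern' x"]) (auto intro!: derivative_eq_intros)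
    qed
    have "?K' s * H (t1 s) (t2 s) - K (t1 s) (t2 s) * ?H' s \<ge> 0"
      unfolding H_def K_def using t[OF s] pos k
      by (intro path_numerator_nonneg)
         (auto intro!: bern_pos bern'_nonpos one_plus_bern'_nonneg bern_mult_antimono)
    moreover have "((\<lambda>s. K (t1 s) (t2 s) / H (t1 s) (t2 s)) has_real_derivative
        (?K' s * H (t1 s) (t2 s) - K (t1 s) (t2 s) * ?H' s) / (H (t1 s) (t2 s) * H (t1 s) (t2 s))) (at s)"
      using H'[OF s] K'[OF s] Hpos[OF s] by (intro DERIV_divide) auto
    ultimately show "\<exists>z. ((\<lambda>s. K (t1 s) (t2 s) / H (t1 s) (t2 s)) has_real_derivative z) (at s) \<and> z \<ge> 0"
      using Hpos[OF s] by (intro exI conjI) (assumption, auto)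
  qed
  then show "K A B / H A B \<le> K C D / H C D" by (simp add: ends)
qed

subsection \<open>The density of the minimum as a function of the baseline\<close>

lemma bern'_mult:
  assumes "t > 0"
  shows "t * bern' t = bern t - bern t * (t + bern t)"
proof -
  have E: "exp t - 1 > 0" using assms by simp
  define y where "y = exp t - 1"
  have y: "y > 0" "exp t = y + 1" using E by (auto simp: y_def)
  show ?thesis
    unfolding bern_def bern'_def using y(1) by (simp add: y(2) field_simps power2_eq_square)
qed

text \<open>The logarithm of the density of the minimum at the point where the baseline equals \<open>exp (- x)\<close>,
  up to a summand that does not depend on \<open>a\<close> and \<open>b\<close>; see \<open>kw_dens_exp\<close>.\<close>

definition kw_log :: "real \<Rightarrow> real \<Rightarrow> real \<Rightarrow> real \<Rightarrow> real \<Rightarrow> real" where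
  "kw_log p q a b x = p * ln (1 - exp (- (a * x))) + q * ln (1 - exp (- (b * x)))
     + ln (p * bern (a * x) + q * bern (b * x))"

lemma ln_one_minus_exp_deriv:
  assumes "a > 0" "x > 0"
  shows "((\<lambda>x. ln (1 - exp (- (a * x)))) has_real_derivative bern (a * x) / x) (at x)"
proof -
  have "a * exp (- (a * x)) / (1 - exp (- (a * x))) = bern (a * x) / x"
    using assms by (simp add: bern_def exp_minus field_simps)
  moreover have "((\<lambda>x. ln (1 - exp (- (a * x)))) has_real_derivative
      a * exp (- (a * x)) / (1 - exp (- (a * x)))) (at x)"
    using assms by (auto intro!: derivative_eq_intros simp: field_simps)
  ultimately show ?thesis by simp
qed

text \<open>The first two logarithms contribute \<open>H / x\<close>; since
  \<open>x H' = H - K\<close> by \<open>bern'_mult\<close>, the third contributes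
  \<open>(1 - K / H) / x\<close>.\<close>

lemma kw_log_deriv:
  assumes "p > 0" "q > 0" "a > 0" "b > 0" "x > 0"
  defines "H \<equiv> p * bern (a * x) + q * bern (b * x)"
    and "K \<equiv> p * (bern (a * x) * (a * x + bern (a * x))) + q * (bern (b * x) * (b * x + bern (b * x)))"
  shows "(kw_log p q a b has_real_derivative (H + 1 - K / H) / x) (at x)"
proof -
  have H: "H > 0"
    unfolding H_def using assms by (auto intro!: add_pos_pos mult_pos_pos bern_pos)
  have "p * a * bern' (a * x) + q * b * bern' (b * x)
      = (p * (a * x * bern' (a * x)) + q * (b * x * bern' (b * x))) / x"
    using assms by (simp add: field_simps)
  also have "\<dots> = (H - K) / x"
    unfolding H_def K_def bern'_mult[OF mult_pos_pos[OF assms(3,5)]] bern'_mult[OF mult_pos_pos[OF assms(4,5)]]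
    by (simp add: algebra_simps)
  finally have D: "((\<lambda>x. p * bern (a * x) + q * bern (b * x)) has_real_derivative (H - K) / x) (at x)"
    using assms by (auto intro!: derivative_eq_intros simp: algebra_simps)
  have "(kw_log p q a b has_real_derivative p * (bern (a * x) / x) + q * (bern (b * x) / x) + (H - K) / x / H) (at x)"
    unfolding kw_log_def[abs_def]
    by (rule DERIV_add[OF DERIV_add[OF DERIV_cmult DERIV_cmult]] ln_one_minus_exp_deriv assms
         DERIV_ln_divide[THEN DERIV_chain2, THEN DERIV_cong])+
       (use H D in \<open>auto simp: H_def\<close>)
  also have "p * (bern (a * x) / x) + q * (bern (b * x) / x) + (H - K) / x / H = (H + 1 - K / H) / x"
    using assms(5) H by (simp add: H_def[symmetric] field_simps)
  finally show ?thesis .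
qed

text \<open>By \<open>bern_path\<close> at arguments scaled by \<open>z\<close>, passing from
  \<open>(a, b)\<close> to \<open>(c, d)\<close> lowers \<open>H\<close> and raises
  \<open>K / H\<close>, hence lowers the derivative of \<open>kw_log\<close>.\<close>

lemma kw_log_diff_antimono:
  fixes a b c d m1 m2 \<beta> \<beta>' :: real
  assumes ord: "0 < b" "b \<le> d" "d \<le> c" "0 < a" and sum: "m1 * a + m2 * b = m1 * c + m2 * d"
    and pos: "m1 > 0" "m2 > 0" "0 < \<beta>" "\<beta> \<le> \<beta>'" and xy: "0 < x" "x \<le> y"
  defines "L \<equiv> kw_log (m1 * \<beta>) (m2 * \<beta>')"
  shows "L c d y - L a b y \<le> L c d x - L a b x"
proof (rule DERIV_nonpos_imp_nonincreasing[OF xy(2)])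
  fix z assume "x \<le> z" "z \<le> y"
  then have z: "z > 0" using xy by simp
  let ?H = "\<lambda>a b. m1*\<beta> * bern (a * z) + m2*\<beta>' * bern (b * z)"
  let ?K = "\<lambda>a b. m1*\<beta> * (bern (a * z) * (a * z + bern (a * z))) + m2*\<beta>' * (bern (b * z) * (b * z + bern (b * z)))"
  have "m1 * (a * z) + m2 * (b * z) = m1 * (c * z) + m2 * (d * z)"
    using sum by algebra
  from bern_path[OF _ _ _ this pos] ord z
  have "?H c d \<le> ?H a b" "?K a b / ?H a b \<le> ?K c d / ?H c d"
    by simp_all
  then have "(?H c d + 1 - ?K c d / ?H c d) / z - (?H a b + 1 - ?K a b / ?H a b) / z \<le> 0"
    using z by (simp add: diff_divide_distrib[symmetric] divide_nonpos_pos)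
  moreover have "((\<lambda>z. L c d z - L a b z) has_real_derivative
      (?H c d + 1 - ?K c d / ?H c d) / z - (?H a b + 1 - ?K a b / ?H a b) / z) (at z)"
    unfolding L_def using ord pos z by (intro DERIV_diff kw_log_deriv) auto
  ultimately show "\<exists>D. ((\<lambda>z. L c d z - L a b z) has_real_derivative D) (at z) \<and> D \<le> 0"
    by blast
qed

section \<open>Survival function and density in the baseline variable\<close>

definition kw_surv :: "real \<Rightarrow> real \<Rightarrow> real \<Rightarrow> real \<Rightarrow> real \<Rightarrow> real" where
  "kw_surv p q a b u = (1 - u powr a) powr p * (1 - u powr b) powr q"

text \<open>The value 0 off the open unit interval costs nothing, as the endpoints are null for the
  uniform law, and it keeps points with baseline 0 or 1 out of the likelihood ratio.\<close>

definition kw_dens :: "real \<Rightarrow> real \<Rightarrow> real \<Rightarrow> real \<Rightarrow> real \<Rightarrow> real" where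
  "kw_dens p q a b u = (if 0 < u \<and> u < 1 then
     kw_surv p q a b u * (p * a * u powr (a - 1) / (1 - u powr a) + q * b * u powr (b - 1) / (1 - u powr b))
   else 0)"

lemma kw_dens_measurable [measurable]: "kw_dens p q a b \<in> borel_measurable borel"
  unfolding kw_dens_def[abs_def] kw_surv_def by measurable

lemma powr_lt_one:
  fixes u a :: real
  assumes "0 < u" "u < 1" "a > 0"
  shows "u powr a < 1"
  using powr_less_mono2[of a u 1] assms by simp

text \<open>With \<open>u = exp (- x)\<close>, each
  \<open>r * u powr (r - 1) / (1 - u powr r)\<close> is \<open>bern (r * x) * (exp x / x)\<close>.
  The last factor is free of parameters and cancels in ratios.\<close>

lemma kw_dens_exp:
  assumes "p > 0" "q > 0" "a > 0" "b > 0" "x > 0"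
  shows "kw_dens p q a b (exp (- x)) = exp (kw_log p q a b x) * (exp x / x)"
proof -
  have pw: "exp (- x) powr r = exp (- (r * x))" for r
    by (simp add: powr_def)
  have 1: "r * exp (- ((r - 1) * x)) / (1 - exp (- (r * x))) = bern (r * x) * (exp x / x)" if "r > 0" for r
    using that assms(5)
    by (simp add: bern_def exp_minus left_diff_distrib exp_diff field_simps)
  have s: "p * a * exp (- ((a - 1) * x)) / (1 - exp (- (a * x))) + q * b * exp (- ((b - 1) * x)) / (1 - exp (- (b * x)))
      = (p * bern (a * x) + q * bern (b * x)) * (exp x / x)"
  proof -
    have "p * a * exp (- ((a - 1) * x)) / (1 - exp (- (a * x))) = p * (bern (a * x) * (exp x / x))"
      by (simp only: 1[OF assms(3), symmetric]) simp
    moreover have "q * b * exp (- ((b - 1) * x)) / (1 - exp (- (b * x))) = q * (bern (b * x) * (exp x / x))"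
      by (simp only: 1[OF assms(4), symmetric]) simp
    ultimately show ?thesis
      by (simp add: algebra_simps)
  qed
  have H: "p * bern (a * x) + q * bern (b * x) > 0"
    using assms by (auto intro!: add_pos_pos mult_pos_pos bern_pos)
  show ?thesis
    unfolding kw_dens_def kw_surv_def pw s kw_log_def exp_add exp_ln[OF H]
    using assms by (simp add: powr_def)
qed

lemma kw_dens_nonneg:
  assumes "p > 0" "q > 0" "a > 0" "b > 0"
  shows "kw_dens p q a b u \<ge> 0"
  unfolding kw_dens_def kw_surv_def
  using assms powr_lt_one[of u a] powr_lt_one[of u b] by (auto simp: less_imp_le)

lemma kw_surv_deriv:
  assumes "a > 0" "b > 0" "0 < u" "u < 1"
  shows "((\<lambda>u. 1 - kw_surv p q a b u) has_real_derivative kw_dens p q a b u) (at u)"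
proof -
  have 1: "1 - u powr a > 0" "1 - u powr b > 0"
    using powr_lt_one[of u] assms by auto
  have d: "((\<lambda>u. (1 - u powr r) powr s) has_real_derivative
      - ((1 - u powr r) powr s * (s * r * u powr (r - 1) / (1 - u powr r)))) (at u)"
    if "1 - u powr r > 0" for r s
    using that assms(3) by (auto intro!: derivative_eq_intros simp: powr_diff field_simps)
  show ?thesis
    unfolding kw_surv_def
    by (rule DERIV_cong[OF DERIV_diff[OF DERIV_const DERIV_mult[OF d[OF 1(1)] d[OF 1(2)]]]])
       (use assms in \<open>simp add: kw_dens_def kw_surv_def algebra_simps\<close>)
qed

text \<open>Continuity up to the endpoints, near which \<open>kw_dens\<close> may be unbounded, lets
  the fundamental theorem of calculus use derivatives in the interior.\<close>

lemma kw_surv_continuous: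
  assumes "p > 0" "q > 0" "a > 0" "b > 0"
  shows "continuous_on {0..1} (kw_surv p q a b)"
  unfolding kw_surv_def[abs_def] using assms
  by (intro continuous_intros continuous_on_powr') (auto simp: powr_le1)

text \<open>The substitution \<open>x = - ln u\<close> reverses the order, so the decreasing
  difference of \<open>kw_log\<close> becomes an increasing ratio.\<close>

lemma kw_dens_ratio_mono:
  fixes a b c d m1 m2 \<beta> \<beta>' :: real
  assumes ord: "0 < b" "b \<le> d" "d \<le> c" "0 < a" and sum: "m1 * a + m2 * b = m1 * c + m2 * d"
    and pos: "m1 > 0" "m2 > 0" "0 < \<beta>" "\<beta> \<le> \<beta>'" and uv: "0 < u" "u \<le> v" "v < 1"
  defines "g \<equiv> kw_dens (m1 * \<beta>) (m2 * \<beta>')"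
  shows "g c d u / g a b u \<le> g c d v / g a b v"
proof -
  let ?L = "kw_log (m1 * \<beta>) (m2 * \<beta>')"
  have ratio: "g c d w / g a b w = exp (?L c d (- ln w) - ?L a b (- ln w))" if "0 < w" "w < 1" for w
  proof -
    have "- ln w > 0" "exp (- (- ln w)) = w" using that by auto
    then show ?thesis
      using kw_dens_exp[of "m1 * \<beta>" "m2 * \<beta>'" c d "- ln w"] kw_dens_exp[of "m1 * \<beta>" "m2 * \<beta>'" a b "- ln w"]
        ord pos by (simp add: g_def exp_diff)
  qed
  have "?L c d (- ln u) - ?L a b (- ln u) \<le> ?L c d (- ln v) - ?L a b (- ln v)"
    by (rule kw_log_diff_antimono[OF ord sum pos]) (use uv in auto)
  with ratio uv show ?thesis by simp
qed

lemma kw_dens_pos: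
  assumes "p > 0" "q > 0" "a > 0" "b > 0" "0 < u" "u < 1"
  shows "kw_dens p q a b u > 0"
proof -
  have x: "- ln u > 0" using assms by simp
  have "kw_dens p q a b (exp (- (- ln u))) > 0"
    unfolding kw_dens_exp[OF assms(1-4) x] by (intro mult_pos_pos divide_pos_pos exp_gt_zero x)
  with assms show ?thesis by simp
qed

subsection \<open>Probability integral transform\<close>

context real_distribution
begin

text \<open>A nonempty set of this kind is a half-line \<open>{..s}\<close>, and continuity forces
  \<open>cdf M s = u\<close>. It can be empty only for \<open>u = 0\<close>.\<close>

lemma prob_cdf_le:
  assumes cont: "continuous_on UNIV (cdf M)" and u: "0 \<le> u" "u < 1"
  shows "prob {t. cdf M t \<le> u} = u"
proof -
  let ?X = "{t. cdf M t \<le> u}"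
  have "eventually (\<lambda>t. u < cdf M t) at_top"
    using order_tendstoD(1)[OF cdf_lim_at_top_prob u(2)] .
  then obtain b where b: "\<And>t. t \<ge> b \<Longrightarrow> u < cdf M t"
    unfolding eventually_at_top_linorder by auto
  have bdd: "bdd_above ?X"
    by (intro bdd_aboveI[of _ b]) (meson b linorder_le_cases mem_Collect_eq not_le)
  show ?thesis
  proof (cases "?X = {}")
    case True
    have "u \<le> 0"
      by (rule tendsto_lowerbound[OF cdf_lim_at_bot])
         (use True in \<open>auto intro!: always_eventually simp: not_le less_imp_le\<close>)
    with u True show ?thesis by simp
  next
    case False
    have closed: "closed ?X"
      using cont by (intro closed_Collect_le) auto
    define s where "s = Sup ?X"
    have s: "s \<in> ?X"
      unfolding s_def by (rule closed_contains_Sup[OF False bdd closed])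
    have X: "cdf M t \<le> u \<longleftrightarrow> t \<le> s" for t
    proof
      show "t \<le> s" if "cdf M t \<le> u"
        unfolding s_def using that by (intro cSup_upper[OF _ bdd]) simp
      show "cdf M t \<le> u" if "t \<le> s"
        using cdf_nondecreasing[OF that] s by simp
    qed
    have "u \<le> cdf M (max s b)"
      using b[of "max s b"] by simp
    \<comment> \<open>A point \<open>z \<ge> s\<close> with value \<open>u\<close> still lies in the
      set, so it is its supremum \<open>s\<close>.\<close>
    then obtain z where z: "s \<le> z" "cdf M z = u"
      using IVT'[of "cdf M" s u "max s b", OF _ _ _ continuous_on_subset[OF cont]] s by auto
    then have "z = s"
      using X[of z] by simp
    have "?X = {..s}"
      using X by blast
    then have "prob ?X = cdf M s"
      by (simp only: cdf_def)
    with z \<open>z = s\<close> show ?thesis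
      by simp
  qed
qed

lemma distr_cdf_uniform:
  assumes cont: "continuous_on UNIV (cdf M)"
  shows "distr M borel (cdf M) = uniform_measure lborel {0..1}"
proof (rule cdf_unique)
  have [measurable]: "cdf M \<in> borel_measurable borel"
    using cont by (rule borel_measurable_continuous_onI)
  have [measurable]: "cdf M \<in> borel_measurable M"
    by simp
  show "real_distribution (distr M borel (cdf M))"
    by (intro real_distribution_distr) simp
  interpret W: prob_space "uniform_measure lborel {0..1::real}"
    by (rule prob_space_uniform_measure) auto
  show "real_distribution (uniform_measure lborel {0..1::real})"
    by unfold_locales auto
  show "cdf (distr M borel (cdf M)) = cdf (uniform_measure lborel {0..1})"
  proof
    fix u :: real
    have "cdf (distr M borel (cdf M)) u = prob {t. cdf M t \<le> u}"
      unfolding cdf_def[of "distr M borel (cdf M)"] by (simp add: measure_distr vimage_def)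
    also have "\<dots> = max 0 (min 1 u)"
    proof -
      consider "u < 0" | "0 \<le> u" "u < 1" | "1 \<le> u" by linarith
      then show ?thesis
      proof cases
        case 1
        have "{t. cdf M t \<le> u} = {}"
          using 1 cdf_nonneg by (force simp: not_le intro: less_le_trans)
        with 1 show ?thesis by simp
      next
        case 2
        with prob_cdf_le[OF cont] show ?thesis by simp
      next
        case 3
        have "{t. cdf M t \<le> u} = UNIV"
          using 3 cdf_bounded_prob order_trans by blast
        with 3 prob_space show ?thesis by simp
      qed
    qed
    also have "\<dots> = cdf (uniform_measure lborel {0..1}) u"
    proof -
      have "{0..1} \<inter> {..u} = {0..min 1 u}" by auto
      then show ?thesis
        by (simp add: cdf_def measure_def emeasure_uniform_measure emeasure_lborel_Icc_eq divide_ennreal_def)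
    qed
    finally show "cdf (distr M borel (cdf M)) u = cdf (uniform_measure lborel {0..1}) u" .
  qed
qed

text \<open>\<open>cdf M\<close> may be constant to the right of \<open>x\<close>, but such a
  stretch carries no mass: both events have probability \<open>cdf M x\<close>.\<close>

lemma AE_le_iff_cdf_le:
  assumes cont: "continuous_on UNIV (cdf M)"
  shows "AE t in M. t \<le> x \<longleftrightarrow> cdf M t \<le> cdf M x"
proof (cases "cdf M x < 1")
  case True
  have [measurable]: "cdf M \<in> borel_measurable borel"
    using cont by (rule borel_measurable_continuous_onI)
  have "prob ({t. cdf M t \<le> cdf M x} - {..x}) = prob {t. cdf M t \<le> cdf M x} - prob {..x}"
    by (rule finite_measure_Diff) (auto intro: cdf_nondecreasing)
  also have "\<dots> = 0"
    using prob_cdf_le[OF cont cdf_nonneg True] by (simp add: cdf_def)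
  finally have "{t. cdf M t \<le> cdf M x} - {..x} \<in> null_sets M"
    by (intro null_setsI) (auto simp: emeasure_eq_measure)
  then show ?thesis
    by (rule AE_I') (use cdf_nondecreasing in \<open>fastforce simp: not_le\<close>)
next
  case False
  then have 1: "cdf M x = 1" using cdf_bounded_prob[of x] by simp
  then have "AE t in M. t \<in> {..x}"
    by (intro AE_prob_1) (simp add: cdf_def)
  then show ?thesis
    by eventually_elim (use 1 cdf_bounded_prob in auto)
qed

end

lemma distributed_cdf_comp:
  fixes D :: "real measure" and f g G :: "real \<Rightarrow> real"
  assumes D: "real_distribution D" and cont: "continuous_on UNIV (cdf D)"
    and f: "\<And>x. 0 \<le> f x" "distributed D lborel (\<lambda>x. x) (\<lambda>x. ennreal (f x))"
    and G: "continuous_on {0..1} G" "G 0 = 0" "G 1 = 1"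
    and der: "\<And>u. 0 < u \<Longrightarrow> u < 1 \<Longrightarrow> (G has_real_derivative g u) (at u)"
    and g: "g \<in> borel_measurable borel" "\<And>u. 0 \<le> g u"
    and M: "prob_space M" and X: "X \<in> borel_measurable M"
    and cdf: "\<And>x. cdf (distr M borel X) x = G (cdf D x)"
  shows "distributed M lborel X (\<lambda>t. ennreal (g (cdf D t) * f t))"
proof -
  interpret D: real_distribution D by (rule D)
  interpret M: prob_space M by (rule M)
  have F [measurable]: "cdf D \<in> borel_measurable borel"
    using cont by (rule borel_measurable_continuous_onI)
  note [measurable] = g(1) X
  have fm [measurable]: "(\<lambda>x. ennreal (f x)) \<in> borel_measurable borel"
    using distributed_borel_measurable[OF f(2)] by simp
  have D_eq: "D = density lborel (\<lambda>x. ennreal (f x))"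
    using distributed_distr_eq_density[OF f(2)] distr_id2[of lborel D] by simp
  define N where "N = density lborel (\<lambda>t. ennreal (g (cdf D t) * f t))"
  have prod: "ennreal (g (cdf D t) * f t) = ennreal (f t) * ennreal (g (cdf D t))" for t
    using f g by (simp add: ennreal_mult mult.commute)
  \<comment> \<open>Used twice: \<open>A = UNIV\<close>, \<open>y = 1\<close> gives total mass 1,
    and \<open>A = {..x}\<close>, \<open>y = cdf D x\<close> gives the distribution
    function.\<close>
  have Nm: "emeasure N A = ennreal (G y)"
    if A [measurable]: "A \<in> sets borel" and y: "0 \<le> y" "y \<le> 1"
      and AE: "AE t in D. t \<in> A \<longleftrightarrow> cdf D t \<le> y" for A y
  proof -
    have "emeasure N A = (\<integral>\<^sup>+ t. ennreal (f t) * (ennreal (g (cdf D t)) * indicator A t) \<partial>lborel)"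
      unfolding N_def prod by (subst emeasure_density) (simp_all add: mult.assoc)
    also have "\<dots> = (\<integral>\<^sup>+ t. ennreal (g (cdf D t)) * indicator A t \<partial>D)"
      by (subst (2) D_eq, subst nn_integral_density) simp_all
    also have "\<dots> = (\<integral>\<^sup>+ t. ennreal (g (cdf D t)) * indicator {..y} (cdf D t) \<partial>D)"
      by (rule nn_integral_cong_AE, use AE in eventually_elim) (simp add: indicator_def)
    also have "\<dots> = (\<integral>\<^sup>+ u. ennreal (g u) * indicator {..y} u \<partial>distr D borel (cdf D))"
      by (subst nn_integral_distr) simp_all
    also have "\<dots> = (\<integral>\<^sup>+ u. ennreal (g u) * indicator {0..y} u \<partial>lborel)"
      unfolding D.distr_cdf_uniform[OF cont]
      by (subst nn_integral_uniform_measure)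
         (use y in \<open>auto intro!: nn_integral_cong simp: indicator_def divide_ennreal_def\<close>)
    also have "\<dots> = ennreal (G y - G 0)"
    proof (rule nn_integral_has_integral_lebesgue')
      show "(g has_integral G y - G 0) {0..y}"
        using y der by (intro fundamental_theorem_of_calculus_interior continuous_on_subset[OF G(1)])
          (auto simp: has_real_derivative_iff_has_vector_derivative[symmetric])
    qed (use g in simp)
    finally show ?thesis by (simp add: G)
  qed
  have sp: "sets N = sets borel" "space N = UNIV" by (simp_all add: N_def)
  interpret N: prob_space N
    by (rule prob_spaceI) (use Nm[of UNIV 1] D.cdf_bounded_prob sp G in simp)
  have "distr M borel X = N"
  proof (rule cdf_unique)
    show "real_distribution (distr M borel X)"
      by (rule M.real_distribution_distr) simp
    show "real_distribution N"
      by unfold_locales (simp_all add: sp)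
    show "cdf (distr M borel X) = cdf N"
    proof
      fix x
      have y: "0 \<le> cdf D x" "cdf D x \<le> 1"
        by (simp_all add: D.cdf_nonneg D.cdf_bounded_prob)
      have "G (cdf D x) \<ge> 0"
        unfolding cdf[symmetric] by (simp add: cdf_def[of "distr M borel X"])
      with Nm[of "{..x}" "cdf D x"] y D.AE_le_iff_cdf_le[OF cont, of x]
      show "cdf (distr M borel X) x = cdf N x"
        by (simp add: cdf cdf_def[of N] measure_def)
    qed
  qed
  then show ?thesis
    unfolding distributed_def N_def
    using distr_cong[of M M borel lborel X X] by (simp add: prod)
qed

section \<open>Distribution of the minimum of independent variables\<close>

lemma measurable_min_stat:
  assumes "\<And>i. i \<in> {1..n} \<Longrightarrow> X i \<in> borel_measurable M"
  shows "min_stat n X \<in> borel_measurable M"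
  unfolding min_stat_def[abs_def] using assms by (intro borel_measurable_Min) auto

text \<open>The minimum exceeds \<open>x\<close> iff every variable does, and by independence the
  survival probabilities multiply.\<close>

lemma (in prob_space) cdf_min_stat:
  assumes ind: "indep_vars (\<lambda>_. borel) X {1..n}" and n: "n \<ge> 1"
  shows "cdf (distr M borel (min_stat n X)) x = 1 - (\<Prod>i=1..n. 1 - cdf (distr M borel (X i)) x)"
proof -
  have Xm: "X i \<in> borel_measurable M" if "i \<in> {1..n}" for i
    using ind that by (auto simp: indep_vars_def)
  have m: "min_stat n X \<in> borel_measurable M"
    by (rule measurable_min_stat) (rule Xm)
  have gt: "prob (Y -` {x<..} \<inter> space M) = 1 - cdf (distr M borel Y) x"
    if [measurable]: "Y \<in> borel_measurable M" for Y
  proof -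
    have "Y -` {x<..} \<inter> space M = space M - Y -` {..x} \<inter> space M" by auto
    then show ?thesis
      by (simp add: cdf_def measure_distr prob_compl)
  qed
  have "min_stat n X -` {x<..} \<inter> space M = (\<Inter>i\<in>{1..n}. X i -` {x<..} \<inter> space M)"
    using n by (auto simp: min_stat_def)
  then have "prob (min_stat n X -` {x<..} \<inter> space M) = (\<Prod>i=1..n. prob (X i -` {x<..} \<inter> space M))"
    using indep_varsD[OF ind, of "{1..n}" "\<lambda>_. {x<..}"] n by simp
  also have "\<dots> = (\<Prod>i=1..n. 1 - cdf (distr M borel (X i)) x)"
    by (intro prod.cong refl gt Xm)
  finally show ?thesis
    using gt[OF m] by simp
qed

subsection \<open>Likelihood ratio order of the minima\<close>

text \<open>The case \<open>n = 0\<close> is excluded because \<open>0 ^ 0\<close> is 1 while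
  \<open>0 powr 0\<close> is 0.\<close>

lemma powr_power_pos_exponent:
  fixes z :: real
  assumes "n \<ge> 1"
  shows "(z powr r) ^ n = z powr (real n * r)"
  using assms by (cases "z = 0") (auto simp: powr_power)

lemma sort_replicate_append:
  fixes a b :: "'a :: linorder"
  assumes "b \<le> a"
  shows "sort (replicate m a @ replicate n b) = replicate n b @ replicate m a"
  using assms by (intro properties_for_sort) (auto simp: sorted_append)

text \<open>The partial sums for \<open>j = 1\<close> are the smallest entries \<open>b\<close> and
  \<open>d\<close>; the totals are the weighted sums.\<close>

lemma majorizes_replicateD:
  assumes "majorizes (replicate m a @ replicate n b) (replicate m c @ replicate n d)"
    and "m \<ge> 1" "n \<ge> 1" "b \<le> a" "d \<le> c"
  shows "b \<le> d" "real m * a + real n * b = real m * c + real n * d"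
proof -
  obtain k where n: "n = Suc k" using assms(3) by (cases n) auto
  have hd: "sum_list (take 1 (sort (replicate m x @ replicate n y))) = y" if "y \<le> x" for x y :: real
    unfolding sort_replicate_append[OF that] by (simp add: n)
  have "1 \<in> {1..<m + n}" using assms by auto
  with assms(1) have "sum_list (take 1 (sort (replicate m a @ replicate n b)))
      \<le> sum_list (take 1 (sort (replicate m c @ replicate n d)))"
    unfolding majorizes_def by simp
  then show "b \<le> d"
    unfolding hd[OF assms(4)] hd[OF assms(5)] .
  show "real m * a + real n * b = real m * c + real n * d"
    using assms(1) by (simp add: majorizes_def sum_list_replicate)
qed

lemma (in prob_space) cdf_min_stat_KwG:
  assumes ind: "indep_vars (\<lambda>_. borel) X {1..n1 + n2}" and n: "n1 \<ge> 1" "n2 \<ge> 1"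
    and 1: "\<And>i. i \<in> {1..n1} \<Longrightarrow> KwG M (X i) a \<beta> F"
    and 2: "\<And>i. i \<in> {n1+1..n1 + n2} \<Longrightarrow> KwG M (X i) b \<beta>' F"
  shows "cdf (distr M borel (min_stat (n1 + n2) X)) x = 1 - kw_surv (real n1 * \<beta>) (real n2 * \<beta>') a b (F x)"
proof -
  have "(\<Prod>i=1..n1 + n2. 1 - cdf (distr M borel (X i)) x)
      = (\<Prod>i=1..n1. 1 - cdf (distr M borel (X i)) x) * (\<Prod>i=n1+1..n1 + n2. 1 - cdf (distr M borel (X i)) x)"
    by (rule prod.ub_add_nat) simp
  also have "(\<Prod>i=1..n1. 1 - cdf (distr M borel (X i)) x) = (\<Prod>i=1..n1. (1 - F x powr a) powr \<beta>)"
    using 1 by (intro prod.cong) (auto simp: KwG_def)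
  also have "(\<Prod>i=n1+1..n1 + n2. 1 - cdf (distr M borel (X i)) x) = (\<Prod>i=n1+1..n1 + n2. (1 - F x powr b) powr \<beta>')"
    using 2 by (intro prod.cong) (auto simp: KwG_def)
  finally show ?thesis
    using n by (subst cdf_min_stat[OF ind]) (simp_all add: powr_power_pos_exponent kw_surv_def)
qed

lemma distributed_min_stat_KwG:
  fixes D :: "real measure"
  assumes D: "real_distribution D" "continuous_on UNIV (cdf D)"
    and f: "\<And>x. 0 \<le> f x" "distributed D lborel (\<lambda>x. x) (\<lambda>x. ennreal (f x))"
    and M: "prob_space M" "prob_space.indep_vars M (\<lambda>_. borel) X {1..n1 + n2}"
    and n: "n1 \<ge> 1" "n2 \<ge> 1"
    and pos: "a > 0" "b > 0" "\<beta> > 0" "\<beta>' > 0"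
    and X: "\<And>i. i \<in> {1..n1} \<Longrightarrow> KwG M (X i) a \<beta> (cdf D)"
      "\<And>i. i \<in> {n1+1..n1 + n2} \<Longrightarrow> KwG M (X i) b \<beta>' (cdf D)"
  shows "distributed M lborel (min_stat (n1 + n2) X)
    (\<lambda>t. ennreal (kw_dens (real n1 * \<beta>) (real n2 * \<beta>') a b (cdf D t) * f t))"
proof (rule distributed_cdf_comp[OF D f])
  interpret prob_space M by (rule M)
  let ?S = "kw_surv (real n1 * \<beta>) (real n2 * \<beta>') a b"
  have pq: "real n1 * \<beta> > 0" "real n2 * \<beta>' > 0" using n pos by auto
  show "continuous_on {0..1} (\<lambda>u. 1 - ?S u)"
    by (intro continuous_on_diff continuous_on_const kw_surv_continuous pq pos)
  show "1 - ?S 0 = 0" "1 - ?S 1 = 1"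
    using pos n by (auto simp: kw_surv_def)
  show "((\<lambda>u. 1 - ?S u) has_real_derivative kw_dens (real n1 * \<beta>) (real n2 * \<beta>') a b u) (at u)"
    if "0 < u" "u < 1" for u
    using that pos by (intro kw_surv_deriv)
  show "0 \<le> kw_dens (real n1 * \<beta>) (real n2 * \<beta>') a b u" for u
    by (intro kw_dens_nonneg pq pos)
  show "min_stat (n1 + n2) X \<in> borel_measurable M"
    using M(2) by (intro measurable_min_stat) (auto simp: indep_vars_def)
  show "cdf (distr M borel (min_stat (n1 + n2) X)) x = 1 - ?S (cdf D x)" for x
    by (rule cdf_min_stat_KwG[OF M(2) n X])
qed (simp_all add: M)

theorem theorem3p4:
  fixes D :: "real measure" and F f :: "real \<Rightarrow> real"
    and M :: "'a measure" and N :: "'b measure"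
    and U :: "nat \<Rightarrow> 'a \<Rightarrow> real" and V :: "nat \<Rightarrow> 'b \<Rightarrow> real"
    and n1 n2 n :: nat
    and \<alpha> \<alpha>' \<beta> \<beta>' \<gamma> \<gamma>' :: real
  assumes "real_distribution D" and "F = cdf D" and "continuous_on UNIV F"
    and "\<And>x. 0 \<le> f x" and "distributed D lborel (\<lambda>x. x) (\<lambda>x. ennreal (f x))"
    and "n1 \<ge> 1" and "n2 \<ge> 1" and "n = n1 + n2"
    and "\<alpha> > 0" and "\<alpha>' > 0" and "\<beta> > 0" and "\<beta>' > 0" and "\<gamma> > 0" and "\<gamma>' > 0"
    and "prob_space M" and "prob_space N"
    and "prob_space.indep_vars M (\<lambda>_. borel) U {1..n}"
    and "prob_space.indep_vars N (\<lambda>_. borel) V {1..n}"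
    and "\<And>i. i \<in> {1..n1} \<Longrightarrow> KwG M (U i) \<alpha> \<beta> F"
    and "\<And>i. i \<in> {1..n1} \<Longrightarrow> KwG N (V i) \<gamma> \<beta> F"
    and "\<And>i. i \<in> {n1+1..n} \<Longrightarrow> KwG M (U i) \<alpha>' \<beta>' F"
    and "\<And>i. i \<in> {n1+1..n} \<Longrightarrow> KwG N (V i) \<gamma>' \<beta>' F"
    and "\<alpha> > \<alpha>'" and "\<gamma> > \<gamma>'" and "\<beta> < \<beta>'"
    and "majorizes (replicate n1 \<alpha> @ replicate n2 \<alpha>') (replicate n1 \<gamma> @ replicate n2 \<gamma>')"
  shows "lr_le M (min_stat n U) N (min_stat n V)"
proof -
  note n = \<open>n1 \<ge> 1\<close> \<open>n2 \<ge> 1\<close>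
  note F = \<open>F = cdf D\<close>
  note pos = \<open>\<alpha> > 0\<close> \<open>\<alpha>' > 0\<close> \<open>\<beta> > 0\<close> \<open>\<beta>' > 0\<close> \<open>\<gamma> > 0\<close> \<open>\<gamma>' > 0\<close>
  note maj = majorizes_replicateD[OF
    \<open>majorizes (replicate n1 \<alpha> @ replicate n2 \<alpha>') (replicate n1 \<gamma> @ replicate n2 \<gamma>')\<close> n]
  have ord: "\<alpha>' \<le> \<gamma>'" and sum: "real n1 * \<alpha> + real n2 * \<alpha>' = real n1 * \<gamma> + real n2 * \<gamma>'"
    using maj \<open>\<alpha> > \<alpha>'\<close> \<open>\<gamma> > \<gamma>'\<close> by auto
  define g where "g = kw_dens (real n1 * \<beta>) (real n2 * \<beta>')"
  have pq: "real n1 * \<beta> > 0" "real n2 * \<beta>' > 0" using n pos by auto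
  have gpos: "0 < u \<Longrightarrow> u < 1 \<Longrightarrow> 0 < g \<alpha> \<alpha>' u" "0 \<le> g \<alpha> \<alpha>' u" "0 \<le> g \<gamma> \<gamma>' u" for u
    unfolding g_def using pq pos by (auto intro!: kw_dens_pos kw_dens_nonneg)
  have out: "0 < u \<and> u < 1" if "g \<alpha> \<alpha>' u \<noteq> 0 \<or> g \<gamma> \<gamma>' u \<noteq> 0" for u
    using that by (auto simp: g_def kw_dens_def split: if_splits)
  have U: "distributed M lborel (min_stat n U) (\<lambda>t. ennreal (g \<alpha> \<alpha>' (F t) * f t))"
    unfolding g_def F \<open>n = n1 + n2\<close>
    by (rule distributed_min_stat_KwG) (use assms in auto)
  have V: "distributed N lborel (min_stat n V) (\<lambda>t. ennreal (g \<gamma> \<gamma>' (F t) * f t))"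
    unfolding g_def F \<open>n = n1 + n2\<close>
    by (rule distributed_min_stat_KwG) (use assms in auto)
  interpret D: real_distribution D by fact
  have "mono_on {t. g \<alpha> \<alpha>' (F t) * f t \<noteq> 0 \<or> g \<gamma> \<gamma>' (F t) * f t \<noteq> 0}
    (\<lambda>t. ennreal (g \<gamma> \<gamma>' (F t) * f t) / ennreal (g \<alpha> \<alpha>' (F t) * f t))" (is "mono_on ?T ?r")
  proof (rule mono_onI)
    fix s t assume st: "s \<in> ?T" "t \<in> ?T" "s \<le> t"
    have inside: "0 < F x" "F x < 1" "f x > 0" if "x \<in> ?T" for x
      using that out[of "F x"] \<open>0 \<le> f x\<close> by auto
    \<comment> \<open>On \<open>?T\<close> the denominator is positive, so the quotient in
      \<open>ennreal\<close> is a real one and the common factor \<open>f x\<close> cancels.\<close>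
    have r: "?r x = ennreal (g \<gamma> \<gamma>' (F x) / g \<alpha> \<alpha>' (F x))" if "x \<in> ?T" for x
      using inside[OF that] gpos[of "F x"] by (subst divide_ennreal) auto
    have "F s \<le> F t"
      unfolding F by (rule D.cdf_nondecreasing[OF st(3)])
    then have "g \<gamma> \<gamma>' (F s) / g \<alpha> \<alpha>' (F s) \<le> g \<gamma> \<gamma>' (F t) / g \<alpha> \<alpha>' (F t)"
      unfolding g_def using inside st ord sum n pos \<open>\<gamma> > \<gamma>'\<close> \<open>\<beta> < \<beta>'\<close>
      by (intro kw_dens_ratio_mono) auto
    then show "?r s \<le> ?r t"
      using r st by (simp add: ennreal_leI)
  qed
  with U V gpos assms(4) show ?thesis
    unfolding lr_le_def by (intro exI[of _ "\<lambda>t. g \<alpha> \<alpha>' (F t) * f t"] exI[of _ "\<lambda>t. g \<gamma> \<gamma>' (F t) * f t"]) simp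
qed

end
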